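(* Assume A1, A2 and A3 (stated in the context), and let $x^\star\in B_{\rho/2}(x_0)$ be a solution of $F(x^\star)=y$ as provided by A3. Let $(\theta_k)_{k\ge 0}$ be any sequence in $(0,2)$. Then the sequence $(x_k)$ given by the relaxed projection Landweber iteration (RPL) (see context), started at $x_0$, is well defined for all $k$, and $$x_k\in B_{\rho/2}(x^\star)\subset B_\rho(x_0)\qquad\text{for all }k\in\mathbb{N}.$$ If, additionally, $\sup_k\theta_k<2$, then $$(1-\eta)^2\sum_{k=0}^\infty \theta_k\,\frac{\|F_0(x_k)\|^4}{\|F'(x_k)^*F_0(x_k)\|^2}<\infty$$ (terms with $F'(x_k)^*F_0(x_k)=0$ being read as $0$), and $(x_k)$ converges strongly to some $\bar x\in B_\rho(x_0)$.
   Context: $X,Y$ are real Hilbert spaces, $F:D(F)\subset X\to Y$ is a (nonlinear) operator, $y\in Y$, and $F_0(x):=F(x)-y$. $B_r(z)$ denotes the open ball of radius $r$ centered at $z$ in $X$. A1: $F$ is continuous on $D(F)$, which has nonempty interior; there are constants $C,\rho>0$ and $x_0\in D(F)$ with $B_\rho(x_0)\subset D(F)$ such that the Gateaux derivative $F'(x)$ (a bounded linear operator $X\to Y$) exists for $x\in B_\rho(x_0)$ and $\|F'(x)\|\le C$ there. A2 (tangential cone condition): there is a constant $\eta\in[0,1)$ such that $\|F(\bar x)-F(x)-F'(x)(\bar x-x)\|\le\eta\|F(\bar x)-F(x)\|$ for all $x,\bar x\in B_\rho(x_0)$. A3: there is $x^\star\in B_{\rho/2}(x_0)$ with $F(x^\star)=y$.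 The relaxed projection Landweber iteration (RPL), exact data: starting at $x_0$, for $k\ge0$, $$x_{k+1}:=x_k-\theta_k\lambda_kF'(x_k)^*F_0(x_k),\qquad \theta_k\in(0,2),$$ where $\lambda_k:=0$ if $F'(x_k)^*F_0(x_k)=0$, and $\lambda_k:=\dfrac{(1-\eta)\|F_0(x_k)\|^2}{\|F'(x_k)^*F_0(x_k)\|^2}$ otherwise. *)

theory Defs
  imports "HOL-Analysis.Analysis"
begin

text \<open>
  An operator \<open>F : D(F) \<subseteq> X \<rightarrow> Y\<close> is a total function together with its domain \<open>D\<close>. Requiring \<open>x\<close> to
  be an interior point of \<open>D\<close> makes the difference quotient, for small \<open>t\<close>, independent of the
  values of \<open>F\<close> off \<open>D\<close>.
\<close>

definition has_gateaux_derivative ::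
    "'a::real_normed_vector set \<Rightarrow> ('a \<Rightarrow> 'b::real_normed_vector) \<Rightarrow> ('a \<Rightarrow>\<^sub>L 'b) \<Rightarrow> 'a \<Rightarrow> bool" where
  "has_gateaux_derivative D F L x \<longleftrightarrow>
     x \<in> interior D \<and>
     (\<forall>h. ((\<lambda>t::real. (F (x + t *\<^sub>R h) - F x) /\<^sub>R t) \<longlongrightarrow> blinfun_apply L h) (at 0))"

definition gateaux_differentiable ::
    "'a::real_normed_vector set \<Rightarrow> ('a \<Rightarrow> 'b::real_normed_vector) \<Rightarrow> 'a \<Rightarrow> bool" where
  "gateaux_differentiable D F x \<longleftrightarrow> (\<exists>L. has_gateaux_derivative D F L x)"

definition gateaux_derivative ::
    "'a::real_normed_vector set \<Rightarrow> ('a \<Rightarrow> 'b::real_normed_vector) \<Rightarrow> 'a \<Rightarrow> ('a \<Rightarrow>\<^sub>L 'b)" where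
  "gateaux_derivative D F x = (THE L. has_gateaux_derivative D F L x)"

lemma has_gateaux_derivative_unique:
  assumes "has_gateaux_derivative D F L x" "has_gateaux_derivative D F M x"
  shows "L = M"
proof (rule blinfun_eqI)
  fix h
  show "blinfun_apply L h = blinfun_apply M h"
    using assms tendsto_unique[OF at_neq_bot] unfolding has_gateaux_derivative_def by blast
qed

lemma gateaux_derivative_eq:
  assumes "has_gateaux_derivative D F L x"
  shows "gateaux_derivative D F x = L"
  unfolding gateaux_derivative_def
  using assms has_gateaux_derivative_unique by blast

definition assumption_A1 ::
    "'a::real_normed_vector set \<Rightarrow> ('a \<Rightarrow> 'b::real_normed_vector) \<Rightarrow> 'a \<Rightarrow> real \<Rightarrow> real \<Rightarrow> bool" where
  "assumption_A1 D F x0 \<rho> C \<longleftrightarrow>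
     continuous_on D F \<and> interior D \<noteq> {} \<and>
     C > 0 \<and> \<rho> > 0 \<and> x0 \<in> D \<and> ball x0 \<rho> \<subseteq> D \<and>
     (\<forall>x\<in>ball x0 \<rho>. gateaux_differentiable D F x \<and> norm (gateaux_derivative D F x) \<le> C)"

definition tangential_cone_condition ::
    "'a::real_normed_vector set \<Rightarrow> ('a \<Rightarrow> 'b::real_normed_vector) \<Rightarrow> 'a \<Rightarrow> real \<Rightarrow> real \<Rightarrow> bool" where
  "tangential_cone_condition D F x0 \<rho> \<eta> \<longleftrightarrow>
     0 \<le> \<eta> \<and> \<eta> < 1 \<and>
     (\<forall>x\<in>ball x0 \<rho>. \<forall>x'\<in>ball x0 \<rho>.
        norm (F x' - F x - blinfun_apply (gateaux_derivative D F x) (x' - x))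
          \<le> \<eta> * norm (F x' - F x))"

definition residual :: "('a \<Rightarrow> 'b::real_normed_vector) \<Rightarrow> 'b \<Rightarrow> 'a \<Rightarrow> 'b" where
  "residual F y x = F x - y"

text \<open>
  The vector \<open>F'(x)\<^sup>* F\<^sub>0(x)\<close>. The library's \<^const>\<open>adjoint\<close> is a choice over all maps satisfying the
  adjoint identity; for bounded operators on a Hilbert space it is the Hilbert adjoint.
\<close>

definition landweber_direction ::
    "'a::real_inner set \<Rightarrow> ('a \<Rightarrow> 'b::real_inner) \<Rightarrow> 'b \<Rightarrow> 'a \<Rightarrow> 'a" where
  "landweber_direction D F y x =
     adjoint (blinfun_apply (gateaux_derivative D F x)) (residual F y x)"

definition rpl_stepsize ::
    "'a::real_inner set \<Rightarrow> ('a \<Rightarrow> 'b::real_inner) \<Rightarrow> 'b \<Rightarrow> real \<Rightarrow> 'a \<Rightarrow> real" where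
  "rpl_stepsize D F y \<eta> x =
     (if landweber_direction D F y x = 0 then 0
      else (1 - \<eta>) * (norm (residual F y x))\<^sup>2 / (norm (landweber_direction D F y x))\<^sup>2)"

text \<open>
  A run of the iteration. Differentiability at every iterate (which includes \<open>x k \<in> interior D\<close>) is
  part of the predicate, so that the existence of a run expresses that no step is undefined.
\<close>

definition is_rpl_sequence ::
    "'a::real_inner set \<Rightarrow> ('a \<Rightarrow> 'b::real_inner) \<Rightarrow> 'b \<Rightarrow> real \<Rightarrow> (nat \<Rightarrow> real) \<Rightarrow> 'a \<Rightarrow>
     (nat \<Rightarrow> 'a) \<Rightarrow> bool" where
  "is_rpl_sequence D F y \<eta> \<theta> x0 x \<longleftrightarrow>
     x 0 = x0 \<and>
     (\<forall>k. gateaux_differentiable D F (x k) \<and>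
          x (Suc k) =
            x k - (\<theta> k * rpl_stepsize D F y \<eta> (x k)) *\<^sub>R landweber_direction D F y (x k))"

end

theory Submission
  imports Defs
begin

text \<open>
  The squared distances \<open>a\<^sub>k = \<parallel>x\<^sub>k - x\<^sup>\<star>\<parallel>\<^sup>2\<close> decrease, since the cone condition at the solution gives
  \<open>\<langle>F'(x)\<^sup>* F\<^sub>0(x), x - x\<^sup>\<star>\<rangle> \<ge> (1 - \<eta>) \<parallel>F\<^sub>0(x)\<parallel>\<^sup>2\<close>; telescoping the decrease gives the summability. If \<open>l\<close>
  minimises the residual over the indices \<open>j, \<dots>, k\<close>, then the cone condition also bounds
  \<open>\<langle>x\<^sub>j - x\<^sub>l, x\<^sub>l - x\<^sup>\<star>\<rangle>\<close> and \<open>\<langle>x\<^sub>l - x\<^sub>k, x\<^sub>l - x\<^sup>\<star>\<rangle>\<close> by multiples of the same telescoping sum, whence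
  \<open>\<parallel>x\<^sub>j - x\<^sub>k\<parallel>\<^sup>2 \<le> M (a\<^sub>j - a\<^sub>k)\<close>. The relaxation parameters may be arbitrarily close to \<open>0\<close>: the limit
  need not be a solution.
\<close>

text \<open>The decreasing nonnegative \<open>a\<close> is Cauchy, and \<open>le\<close> passes this
  on to \<open>x\<close> because it controls all pairs of indices, not only consecutive
  ones.\<close>

lemma convergent_if_dist_le_decrease:
  fixes x :: "nat \<Rightarrow> 'a::{real_normed_vector, complete_space}"
  assumes "decseq a" "\<And>k. 0 \<le> a k"
    and le: "\<And>j k. j \<le> k \<Longrightarrow> (norm (x j - x k))\<^sup>2 \<le> M * (a j - a k :: real)"
  shows "convergent x"
proof -
  have "Bseq a"
    using assms by (intro BseqI'[of _ "a 0"]) (simp add: decseq_def)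
  then have "Cauchy (\<lambda>k. M * a k)"
    using assms(1) by (intro convergent_Cauchy convergent_mult convergent_const
        Bseq_monoseq_convergent) (auto simp: monoseq_iff)
  have "Cauchy x"
  proof (rule metric_CauchyI)
    fix e :: real assume "0 < e"
    then have "0 < e\<^sup>2" by simp
    from metric_CauchyD[OF \<open>Cauchy (\<lambda>k. M * a k)\<close> this] obtain N where
      N: "\<And>m n. m \<ge> N \<Longrightarrow> n \<ge> N \<Longrightarrow> \<bar>M * a m - M * a n\<bar> < e\<^sup>2"
      by (auto simp: dist_real_def)
    have *: "dist (x m) (x n) < e" if "m \<ge> N" "n \<ge> N" "m \<le> n" for m n
    proof -
      have "(norm (x m - x n))\<^sup>2 < e\<^sup>2"
        using le[OF that(3)] N[OF that(1,2)] by (simp add: algebra_simps abs_if split: if_splits)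
      then show ?thesis
        using \<open>0 < e\<close> by (simp add: dist_norm power_less_imp_less_base)
    qed
    then show "\<exists>N. \<forall>m\<ge>N. \<forall>n\<ge>N. dist (x m) (x n) < e"
      by (metis dist_commute linear)
  qed
  then show ?thesis by (simp add: Cauchy_convergent_iff)
qed

subsection \<open>The Hilbert adjoint\<close>

lemma riesz_representation:
  fixes \<phi> :: "'a::{real_inner, complete_space} \<Rightarrow> real"
  assumes "bounded_linear \<phi>"
  shows "\<exists>z. \<forall>h. \<phi> h = h \<bullet> z"
proof -
  interpret \<phi>: bounded_linear \<phi> by fact
  \<comment> \<open>The representing vector is the minimiser of this functional.\<close>
  define J where "J x = x \<bullet> x - 2 * \<phi> x" for x
  define m where "m = (INF x. J x)"
  obtain K where K: "\<And>x. \<bar>\<phi> x\<bar> \<le> norm x * K"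
    using \<phi>.bounded by auto
  have lower: "- K\<^sup>2 \<le> J x" for x
  proof -
    have "0 \<le> (norm x - K)\<^sup>2" by simp
    then show ?thesis
      using K[of x] by (simp add: J_def power2_eq_square algebra_simps flip: power2_norm_eq_inner)
  qed
  then have bdd: "bdd_below (range J)" by (rule bdd_belowI2)
  have m_le: "m \<le> J x" for x unfolding m_def by (rule cINF_lower[OF bdd]) simp
  have "\<exists>x. J x < m + 1 / Suc n" for n
    using cINF_less_iff[OF _ bdd, of "m + 1 / Suc n"] unfolding m_def by auto
  then obtain u where u: "\<And>n. J (u n) < m + 1 / Suc n" by metis
  \<comment> \<open>Parallelogram identity: \<open>J\<close> is at least \<open>m\<close> at the
    midpoint, so almost-minimisers lie close together.\<close>
  have para: "(norm (v - w))\<^sup>2 \<le> 2 * (J v - m) + 2 * (J w - m)" for v w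
  proof -
    have "(norm (v - w))\<^sup>2 = 2 * J v + 2 * J w - 4 * J ((1/2) *\<^sub>R (v + w))"
      unfolding J_def power2_norm_eq_inner
      by (simp add: \<phi>.add \<phi>.scaleR inner_commute algebra_simps)
    then show ?thesis using m_le[of "(1/2) *\<^sub>R (v + w)"] by simp
  qed
  have "Cauchy u"
  proof (rule metric_CauchyI)
    fix e :: real assume "0 < e"
    then obtain N where N: "1 / Suc N < e\<^sup>2 / 4"
      using nat_approx_posE[of "e\<^sup>2 / 4"] by auto
    have close: "4 * (J (u n) - m) < e\<^sup>2" if "n \<ge> N" for n
    proof -
      have "1 / real (Suc n) \<le> 1 / Suc N" using that by (simp add: frac_le)
      then show ?thesis using u[of n] N by argo
    qed
    have "dist (u i) (u j) < e" if "i \<ge> N" "j \<ge> N" for i j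
    proof -
      have "(norm (u i - u j))\<^sup>2 < e\<^sup>2"
        using para[of "u i" "u j"] close[OF that(1)] close[OF that(2)] by linarith
      then show ?thesis
        using \<open>0 < e\<close> by (simp add: dist_norm power_less_imp_less_base)
    qed
    then show "\<exists>N. \<forall>i\<ge>N. \<forall>j\<ge>N. dist (u i) (u j) < e" by blast
  qed
  then obtain z where z: "u \<longlonglongrightarrow> z"
    by (auto simp: Cauchy_convergent_iff convergent_def)
  have "(\<lambda>n. J (u n)) \<longlonglongrightarrow> J z"
    unfolding J_def by (intro tendsto_intros \<phi>.tendsto z)
  moreover have "(\<lambda>n. m + 1 / real (Suc n)) \<longlonglongrightarrow> m + 0"
    by (intro tendsto_intros LIMSEQ_Suc[OF lim_1_over_n])
  ultimately have Jz: "J z \<le> m"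
    using u LIMSEQ_le[of "\<lambda>n. J (u n)" "J z"] by (force intro: less_imp_le)
  have "\<phi> h = h \<bullet> z" for h
  proof (cases "h = 0")
    case False
    \<comment> \<open>\<open>d\<close> is half the derivative of \<open>J\<close> at
      \<open>z\<close> in direction \<open>h\<close>, and \<open>t\<close> minimises the quadratic
      \<open>J (z + t *\<^sub>R h)\<close>; minimality of \<open>z\<close> then forces
      \<open>d = 0\<close>.\<close>
    define d t where "d = h \<bullet> z - \<phi> h" and "t = - (d / (h \<bullet> h))"
    have "J (z + t *\<^sub>R h) = J z + 2 * t * d + t * t * (h \<bullet> h)"
      by (simp add: J_def d_def \<phi>.add \<phi>.scaleR inner_commute algebra_simps)
    also have "\<dots> = J z - d\<^sup>2 / (h \<bullet> h)"
      using False by (simp add: t_def field_simps power2_eq_square)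
    finally have "d\<^sup>2 / (h \<bullet> h) \<le> 0" using m_le[of "z + t *\<^sub>R h"] Jz by simp
    moreover have "0 < h \<bullet> h" using False by simp
    ultimately have "d = 0" by (simp add: divide_le_0_iff)
    then show ?thesis by (simp add: d_def)
  qed simp
  then show ?thesis by blast
qed

text \<open>\<open>adjoint\<close> is a choice, so the identity holds once some map satisfies it;
  Riesz representation supplies the values of such a map, one \<open>v\<close> at a time.\<close>

lemma inner_blinfun_adjoint:
  fixes L :: "'a::{real_inner, complete_space} \<Rightarrow>\<^sub>L 'b::real_inner"
  shows "blinfun_apply L x \<bullet> v = x \<bullet> adjoint (blinfun_apply L) v"
proof -
  have "\<exists>z. \<forall>x. blinfun_apply L x \<bullet> v = x \<bullet> z" for v
    by (intro riesz_representation bounded_linear_inner_left_comp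
        blinfun.bounded_linear_right)
  then have "\<exists>g. \<forall>x v. blinfun_apply L x \<bullet> v = x \<bullet> g v" by metis
  then show ?thesis
    unfolding adjoint_def by (rule someI2_ex) blast
qed

subsection \<open>The iteration\<close>

locale tangential_cone =
  fixes D :: "'a::{real_inner, complete_space} set"
    and F :: "'a \<Rightarrow> 'b::real_inner"
    and y :: 'b and x0 xstar :: 'a and \<rho> \<eta> :: real
  assumes differentiable: "z \<in> ball x0 \<rho> \<Longrightarrow> gateaux_differentiable D F z"
    and cone: "tangential_cone_condition D F x0 \<rho> \<eta>"
    and xstar: "xstar \<in> ball x0 (\<rho> / 2)" "F xstar = y"
begin

abbreviation "F' z \<equiv> blinfun_apply (gateaux_derivative D F z)"
abbreviation "res \<equiv> residual F y"
abbreviation "dir \<equiv> landweber_direction D F y"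
abbreviation "lam \<equiv> rpl_stepsize D F y \<eta>"
abbreviation "relaxed_step t z \<equiv> z - (t * lam z) *\<^sub>R dir z"

section \<open>Geometry of the balls and the decrease in one step\<close>

lemma eta: "0 \<le> \<eta>" "\<eta> < 1"
  using cone by (auto simp: tangential_cone_condition_def)

lemma rho_pos: "0 < \<rho>"
  using xstar(1) zero_le_dist[of x0 xstar] unfolding mem_ball by linarith

lemma ball_xstar_subset: "ball xstar (\<rho> / 2) \<subseteq> ball x0 \<rho>"
proof
  fix z assume "z \<in> ball xstar (\<rho> / 2)"
  then show "z \<in> ball x0 \<rho>"
    using xstar(1) dist_triangle[of x0 z xstar] by simp
qed

lemma xstar_in_ball: "xstar \<in> ball x0 \<rho>"
  by (rule subsetD[OF ball_xstar_subset]) (simp add: rho_pos)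

lemma coneD:
  assumes "z \<in> ball x0 \<rho>" "w \<in> ball x0 \<rho>"
  shows "norm (F w - F z - F' z (w - z)) \<le> \<eta> * norm (F w - F z)"
  using cone assms by (auto simp: tangential_cone_condition_def)

lemma inner_dir: "h \<bullet> dir z = F' z h \<bullet> res z"
  by (simp add: landweber_direction_def inner_blinfun_adjoint)

text \<open>By the cone condition the linearisation error \<open>?d\<close> has norm at most
  \<open>\<eta> * norm (res z)\<close>, so by Cauchy-Schwarz it removes at most the fraction
  \<open>\<eta>\<close> of the squared residual.\<close>

lemma inner_dir_ge:
  assumes "z \<in> ball x0 \<rho>"
  shows "(1 - \<eta>) * (norm (res z))\<^sup>2 \<le> (z - xstar) \<bullet> dir z"
proof -
  let ?d = "F' z (z - xstar) - res z"
  have "F xstar - F z - F' z (xstar - z) = ?d"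
    by (simp add: residual_def xstar(2) blinfun.diff_right)
  moreover have "norm (F xstar - F z) = norm (res z)"
    by (simp add: residual_def xstar(2) norm_minus_commute)
  ultimately have "norm ?d \<le> \<eta> * norm (res z)"
    using coneD[OF assms xstar_in_ball] by (simp only:)
  then have "norm ?d * norm (res z) \<le> \<eta> * (norm (res z))\<^sup>2"
    by (simp add: power2_eq_square mult_right_mono flip: mult.assoc)
  moreover have "\<bar>?d \<bullet> res z\<bar> \<le> norm ?d * norm (res z)"
    by (rule Cauchy_Schwarz_ineq2)
  moreover have "(z - xstar) \<bullet> dir z = ?d \<bullet> res z + (norm (res z))\<^sup>2"
    by (simp add: inner_dir inner_diff_left power2_norm_eq_inner)
  ultimately show ?thesis by (simp add: algebra_simps)
qed

text \<open>Where \<open>dir z = 0\<close>, the stepsize is \<open>0\<close> by convention and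
  \<open>inner_dir_ge\<close> forces \<open>res z = 0\<close>; both sides vanish.\<close>

lemma stepsize_times_dir:
  assumes "z \<in> ball x0 \<rho>"
  shows "lam z * (norm (dir z))\<^sup>2 = (1 - \<eta>) * (norm (res z))\<^sup>2"
proof (cases "dir z = 0")
  case True
  then have "(1 - \<eta>) * (norm (res z))\<^sup>2 \<le> 0" using inner_dir_ge[OF assms] by simp
  then have "res z = 0" using eta by (simp add: mult_le_0_iff)
  then show ?thesis using True by simp
qed (simp add: rpl_stepsize_def)

lemma stepsize_nonneg: "0 \<le> lam z"
  using eta by (simp add: rpl_stepsize_def)

text \<open>Expand the square: \<open>inner_dir_ge\<close> bounds the cross term, and
  \<open>stepsize_times_dir\<close> gives the quadratic term the same form, so that the factor
  \<open>2 * t - t * t\<close> remains.\<close>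

lemma norm_relaxed_step:
  assumes z: "z \<in> ball x0 \<rho>" and t: "0 \<le> t"
  shows "t * (2 - t) * (1 - \<eta>) * (lam z * (norm (res z))\<^sup>2)
    \<le> (norm (z - xstar))\<^sup>2 - (norm (relaxed_step t z - xstar))\<^sup>2"
proof -
  let ?e = "z - xstar" and ?c = "t * lam z"
  have square: "(norm (e - c *\<^sub>R d))\<^sup>2 = (norm e)\<^sup>2 - 2 * c * (e \<bullet> d) + c * c * (norm d)\<^sup>2"
    for e d :: 'a and c
    by (simp add: power2_norm_eq_inner inner_commute algebra_simps)
  have "relaxed_step t z - xstar = ?e - ?c *\<^sub>R dir z" by simp
  then have "(norm (relaxed_step t z - xstar))\<^sup>2
      = (norm ?e)\<^sup>2 - 2 * ?c * (?e \<bullet> dir z) + ?c * ?c * (norm (dir z))\<^sup>2"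
    by (simp only: square)
  also have "\<dots> = (norm ?e)\<^sup>2 - 2 * ?c * (?e \<bullet> dir z) + ?c * t * ((1 - \<eta>) * (norm (res z))\<^sup>2)"
    by (simp flip: stepsize_times_dir[OF z])
  finally have eq: "(norm (relaxed_step t z - xstar))\<^sup>2
      = (norm ?e)\<^sup>2 - 2 * ?c * (?e \<bullet> dir z) + ?c * t * ((1 - \<eta>) * (norm (res z))\<^sup>2)" .
  have "2 * ?c * ((1 - \<eta>) * (norm (res z))\<^sup>2) \<le> 2 * ?c * (?e \<bullet> dir z)"
    by (intro mult_left_mono inner_dir_ge z) (simp add: t stepsize_nonneg)
  then show ?thesis unfolding eq by (simp add: algebra_simps)
qed

lemma relaxed_step_in_ball:
  assumes "z \<in> ball xstar (\<rho> / 2)" and "0 < t" "t < 2"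
  shows "relaxed_step t z \<in> ball xstar (\<rho> / 2)"
proof -
  have "z \<in> ball x0 \<rho>" using assms(1) ball_xstar_subset by blast
  moreover have "0 \<le> t * (2 - t) * (1 - \<eta>) * (lam z * (norm (res z))\<^sup>2)"
    using assms eta stepsize_nonneg by simp
  ultimately have "(norm (relaxed_step t z - xstar))\<^sup>2 \<le> (norm (z - xstar))\<^sup>2"
    using norm_relaxed_step[of z t] assms(2) by linarith
  then have "norm (relaxed_step t z - xstar) \<le> norm (z - xstar)"
    by (rule power2_le_imp_le) simp
  then show ?thesis using assms(1) by (simp add: dist_norm norm_minus_commute)
qed

section \<open>Upper bounds from the cone condition\<close>

lemma norm_derivative_le:
  assumes "z \<in> ball x0 \<rho>" "w \<in> ball x0 \<rho>"
  shows "norm (F' z (w - z)) \<le> (1 + \<eta>) * norm (F w - F z)"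
proof -
  have "norm (F' z (w - z)) \<le> norm (F w - F z) + norm (F w - F z - F' z (w - z))"
    using norm_triangle_ineq4[of "F w - F z" "F w - F z - F' z (w - z)"] by simp
  then show ?thesis using coneD[OF assms] by (simp add: algebra_simps)
qed

text \<open>Split \<open>w - xstar\<close> at \<open>z\<close>. The constant 3 is 2 + 1: the
  residuals at \<open>w\<close> and \<open>z\<close> differ by at most
  \<open>2 * norm (res z)\<close>, those at \<open>xstar\<close> and \<open>z\<close> by
  \<open>norm (res z)\<close>.\<close>

lemma inner_dir_le:
  assumes z: "z \<in> ball x0 \<rho>" and w: "w \<in> ball x0 \<rho>"
    and le: "norm (res w) \<le> norm (res z)"
  shows "\<bar>(w - xstar) \<bullet> dir z\<bar> \<le> 3 * (1 + \<eta>) * (norm (res z))\<^sup>2"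
proof -
  have "F' z (w - xstar) = F' z (w - z) - F' z (xstar - z)"
    by (simp flip: blinfun.diff_right)
  then have "norm (F' z (w - xstar)) \<le> norm (F' z (w - z)) + norm (F' z (xstar - z))"
    by (simp add: norm_triangle_ineq4)
  also have "\<dots> \<le> (1 + \<eta>) * norm (F w - F z) + (1 + \<eta>) * norm (F xstar - F z)"
    using norm_derivative_le[OF z w] norm_derivative_le[OF z xstar_in_ball] by linarith
  also have "\<dots> = (1 + \<eta>) * (norm (res w - res z) + norm (res z))"
    by (simp add: residual_def xstar(2) norm_minus_commute algebra_simps)
  also have "\<dots> \<le> (1 + \<eta>) * (3 * norm (res z))"
    using norm_triangle_ineq4[of "res w" "res z"] le eta by (intro mult_left_mono) auto
  finally have "norm (F' z (w - xstar)) * norm (res z) \<le> (1 + \<eta>) * (3 * norm (res z)) * norm (res z)"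
    by (rule mult_right_mono) simp
  then show ?thesis
    using Cauchy_Schwarz_ineq2[of "F' z (w - xstar)" "res z"]
    by (simp add: inner_dir power2_eq_square algebra_simps)
qed

section \<open>Existence and uniqueness of the run\<close>

lemma run_in_ball:
  assumes "x 0 = x0" and "\<And>k. x (Suc k) = relaxed_step (\<theta> k) (x k)"
    and "\<And>k. 0 < \<theta> k \<and> \<theta> k < 2"
  shows "x k \<in> ball xstar (\<rho> / 2)"
proof (induction k)
  case 0
  then show ?case using xstar(1) assms(1) by (simp add: dist_commute)
next
  case (Suc k)
  then show ?case using relaxed_step_in_ball assms by simp
qed

text \<open>The recursion always yields a total sequence; it is a run because it never leaves the
  ball on which \<open>F\<close> is differentiable.\<close>

lemma ex1_rpl_sequence:
  assumes "\<And>k. 0 < \<theta> k \<and> \<theta> k < 2"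
  shows "\<exists>!x. is_rpl_sequence D F y \<eta> \<theta> x0 x"
proof
  let ?x = "rec_nat x0 (\<lambda>k. relaxed_step (\<theta> k))"
  have "?x k \<in> ball xstar (\<rho> / 2)" for k
    by (rule run_in_ball[where \<theta> = \<theta>]) (simp_all add: assms)
  then have "?x k \<in> ball x0 \<rho>" for k
    using ball_xstar_subset by blast
  then show "is_rpl_sequence D F y \<eta> \<theta> x0 ?x"
    by (simp add: is_rpl_sequence_def differentiable)
  fix x assume x: "is_rpl_sequence D F y \<eta> \<theta> x0 x"
  have "x k = ?x k" for k
    using x by (induction k) (simp_all add: is_rpl_sequence_def)
  then show "x = ?x" by blast
qed

section \<open>Relaxation bounded away from 2: summability and strong convergence\<close>

context
  fixes x :: "nat \<Rightarrow> 'a" and \<theta> :: "nat \<Rightarrow> real" and q :: real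
  assumes init: "x 0 = x0" and step: "\<And>k. x (Suc k) = relaxed_step (\<theta> k) (x k)"
    and theta_pos: "\<And>k. 0 < \<theta> k" and theta_le: "\<And>k. \<theta> k \<le> q" and q: "q < 2"
begin

lemma theta_bounds: "0 < \<theta> k \<and> \<theta> k < 2"
  using theta_pos[of k] theta_le[of k] q by simp

lemma x_in_ball: "x k \<in> ball x0 \<rho>"
  using run_in_ball[OF init step theta_bounds] ball_xstar_subset by blast

abbreviation "dist2 k \<equiv> (norm (x k - xstar))\<^sup>2"
text \<open>\<open>(1 - \<eta>) * gain k\<close> is the term of index \<open>k\<close> of the series
  in the theorem.\<close>

abbreviation "gain k \<equiv> \<theta> k * (lam (x k) * (norm (res (x k)))\<^sup>2)"

lemma gain_nonneg: "0 \<le> gain k"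
  using theta_bounds[of k] stepsize_nonneg by simp

text \<open>The bound \<open>q\<close> replaces the factor \<open>2 - \<theta> k\<close> by a
  positive constant, so that the right-hand side can be telescoped.\<close>

lemma gain_le: "(2 - q) * (1 - \<eta>) * gain k \<le> dist2 k - dist2 (Suc k)"
proof -
  have "(2 - q) * ((1 - \<eta>) * gain k) \<le> (2 - \<theta> k) * ((1 - \<eta>) * gain k)"
    using theta_le eta gain_nonneg by (intro mult_right_mono) simp_all
  also have "\<dots> = \<theta> k * (2 - \<theta> k) * (1 - \<eta>) * (lam (x k) * (norm (res (x k)))\<^sup>2)" by simp
  also have "\<dots> \<le> dist2 k - dist2 (Suc k)"
    unfolding step using norm_relaxed_step[OF x_in_ball] theta_bounds by (simp add: less_imp_le)
  finally show ?thesis by (simp only: mult.assoc)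
qed

lemma decseq_dist2: "decseq dist2"
proof (rule decseq_SucI)
  fix k
  have "0 \<le> (2 - q) * (1 - \<eta>) * gain k"
    by (rule mult_nonneg_nonneg[OF _ gain_nonneg]) (use q eta in simp)
  then show "dist2 (Suc k) \<le> dist2 k" using gain_le[of k] by linarith
qed

lemma summable_gain: "summable gain"
proof -
  have c: "0 < (2 - q) * (1 - \<eta>)" using q eta by simp
  have "convergent dist2"
    using decseq_dist2 by (intro Bseq_monoseq_convergent BseqI'[of _ "dist2 0"])
      (auto simp: monoseq_iff decseq_def)
  then have "summable (\<lambda>k. dist2 k - dist2 (Suc k))"
    unfolding convergent_def using telescope_summable' by blast
  then have "summable (\<lambda>k. (2 - q) * (1 - \<eta>) * gain k)"
    by (rule summable_comparison_test'[where N = 0])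
      (use gain_le gain_nonneg c in simp)
  then show ?thesis using c by (subst (asm) summable_cmult_iff) auto
qed

text \<open>The constant of \<open>inner_dir_le\<close> divided by that of
  \<open>gain_le\<close>.\<close>

definition "coupling = 3 * (1 + \<eta>) / ((2 - q) * (1 - \<eta>))"

lemma coupling_nonneg: "0 \<le> coupling"
  using q eta by (simp add: coupling_def)

text \<open>Each step is a multiple of \<open>dir (x i)\<close>, so \<open>inner_dir_le\<close> and
  \<open>gain_le\<close> bound its contribution by a decrease of \<open>dist2\<close>, and these add
  up. Only directions with \<open>i < v\<close> enter.\<close>

lemma inner_increment_le:
  assumes w: "w \<in> ball x0 \<rho>" and "u \<le> v"
    and "\<And>i. u \<le> i \<Longrightarrow> i < v \<Longrightarrow> norm (res w) \<le> norm (res (x i))"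
  shows "\<bar>(w - xstar) \<bullet> (x u - x v)\<bar> \<le> coupling * (dist2 u - dist2 v)"
  using assms(2,3)
proof (induction v rule: dec_induct)
  case (step v)
  have "(w - xstar) \<bullet> (x v - x (Suc v)) = \<theta> v * lam (x v) * ((w - xstar) \<bullet> dir (x v))"
    by (simp add: \<open>\<And>k. x (Suc k) = relaxed_step (\<theta> k) (x k)\<close>)
  then have "\<bar>(w - xstar) \<bullet> (x v - x (Suc v))\<bar>
      = \<theta> v * lam (x v) * \<bar>(w - xstar) \<bullet> dir (x v)\<bar>"
    using theta_bounds[of v] stepsize_nonneg[of "x v"] by (simp add: abs_mult)
  also have "\<dots> \<le> \<theta> v * lam (x v) * (3 * (1 + \<eta>) * (norm (res (x v)))\<^sup>2)"
    using theta_bounds[of v] stepsize_nonneg[of "x v"] step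
    by (intro mult_left_mono inner_dir_le x_in_ball w) auto
  also have "\<dots> = coupling * ((2 - q) * (1 - \<eta>) * gain v)"
    using q eta by (simp add: coupling_def)
  also have "\<dots> \<le> coupling * (dist2 v - dist2 (Suc v))"
    by (intro mult_left_mono gain_le coupling_nonneg)
  finally have "\<bar>(w - xstar) \<bullet> (x v - x (Suc v))\<bar> \<le> coupling * (dist2 v - dist2 (Suc v))" .
  moreover have "\<bar>(w - xstar) \<bullet> (x u - x v)\<bar> \<le> coupling * (dist2 u - dist2 v)"
    using step by simp
  moreover have "(w - xstar) \<bullet> (x u - x (Suc v))
      = (w - xstar) \<bullet> (x u - x v) + (w - xstar) \<bullet> (x v - x (Suc v))"
    by (simp flip: inner_add_right)
  ultimately show ?case unfolding right_diff_distrib by linarith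
qed simp

lemma norm_increment_le:
  assumes "j \<le> k"
  shows "(norm (x j - x k))\<^sup>2 \<le> 2 * (1 + 2 * coupling) * (dist2 j - dist2 k)"
proof -
  \<comment> \<open>Passing through the index of least residual lets
    \<open>inner_increment_le\<close> apply with \<open>w = x l\<close> on both sides of
    \<open>l\<close>.\<close>
  obtain l where l: "j \<le> l" "l \<le> k" and
    minimal: "\<And>i. j \<le> i \<Longrightarrow> i \<le> k \<Longrightarrow> norm (res (x l)) \<le> norm (res (x i))"
    using ex_is_arg_min_if_finite[of "{j..k}" "\<lambda>i. norm (res (x i))"] assms
    by (force simp: is_arg_min_linorder)
  let ?d = "x l - xstar"
  have expand: "(1 + 2 * coupling) * s = s + 2 * (coupling * s)" for s
    by (simp add: algebra_simps)
  have polar: "(norm (v - x l))\<^sup>2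
      = (norm (v - xstar))\<^sup>2 - (norm ?d)\<^sup>2 - 2 * (?d \<bullet> (v - x l))" for v
    unfolding power2_norm_eq_inner by (simp add: inner_commute algebra_simps)
  have "\<bar>?d \<bullet> (x j - x l)\<bar> \<le> coupling * (dist2 j - dist2 l)"
    by (intro inner_increment_le x_in_ball l(1) minimal) (use l in auto)
  then have 1: "(norm (x j - x l))\<^sup>2 \<le> (1 + 2 * coupling) * (dist2 j - dist2 l)"
    unfolding polar expand by linarith
  have "\<bar>?d \<bullet> (x l - x k)\<bar> \<le> coupling * (dist2 l - dist2 k)"
    by (intro inner_increment_le x_in_ball l(2) minimal) (use l in auto)
  moreover have "?d \<bullet> (x k - x l) = - (?d \<bullet> (x l - x k))"
    by (simp flip: inner_minus_right)
  \<comment> \<open>Since \<open>k\<close> comes after \<open>l\<close>, \<open>polar\<close> yields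
    \<open>dist2 k - dist2 l\<close>; being nonpositive, it is at most
    \<open>dist2 l - dist2 k\<close>.\<close>
  moreover have "dist2 k \<le> dist2 l" using decseq_dist2 l(2) by (rule decseqD)
  ultimately have 2: "(norm (x k - x l))\<^sup>2 \<le> (1 + 2 * coupling) * (dist2 l - dist2 k)"
    unfolding polar expand by linarith
  \<comment> \<open>Parallelogram identity for the two legs from \<open>x l\<close>; dropping the
    second square yields the outer factor 2.\<close>
  have "(norm (x j - x k))\<^sup>2 + (norm ((x j - x l) + (x k - x l)))\<^sup>2
      = 2 * (norm (x j - x l))\<^sup>2 + 2 * (norm (x k - x l))\<^sup>2"
    unfolding power2_norm_eq_inner by (simp add: inner_commute algebra_simps)
  then have "(norm (x j - x k))\<^sup>2 \<le> 2 * (norm (x j - x l))\<^sup>2 + 2 * (norm (x k - x l))\<^sup>2"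
    by (smt (verit) zero_le_power2)
  with 1 2 show ?thesis by (simp add: algebra_simps)
qed

lemma run_converges: "\<exists>xbar\<in>ball x0 \<rho>. x \<longlonglongrightarrow> xbar"
proof -
  have "convergent x"
    by (rule convergent_if_dist_le_decrease[OF decseq_dist2 _ norm_increment_le]) simp_all
  then obtain xbar where lim: "x \<longlonglongrightarrow> xbar" by (auto simp: convergent_def)
  \<comment> \<open>An open ball need not contain limits of its points; the fixed radius
    \<open>norm (x0 - xstar)\<close>, strictly below \<open>\<rho> / 2\<close>, keeps the limit
    inside.\<close>
  have "norm (x k - xstar) \<le> norm (x0 - xstar)" for k
    using decseqD[OF decseq_dist2, of 0 k] init by (auto intro: power2_le_imp_le)
  moreover have "(\<lambda>k. norm (x k - xstar)) \<longlonglongrightarrow> norm (xbar - xstar)"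
    by (intro tendsto_intros lim)
  ultimately have "norm (xbar - xstar) \<le> norm (x0 - xstar)"
    by (auto intro: LIMSEQ_le_const2)
  then have "xbar \<in> ball xstar (\<rho> / 2)"
    using xstar(1) by (simp add: dist_norm norm_minus_commute)
  then show ?thesis using lim ball_xstar_subset by blast
qed

text \<open>The default \<open>lam (x k) = 0\<close> at a vanishing direction agrees with the
  convention that the term is \<open>0\<close>.\<close>

lemma summable_run:
  "summable (\<lambda>k. (1 - \<eta>)\<^sup>2 * (if dir (x k) = 0 then 0
     else \<theta> k * ((norm (res (x k))) ^ 4 / (norm (dir (x k)))\<^sup>2)))"
proof -
  have "(1 - \<eta>) * gain k = (1 - \<eta>)\<^sup>2 * (if dir (x k) = 0 then 0
     else \<theta> k * ((norm (res (x k))) ^ 4 / (norm (dir (x k)))\<^sup>2))" for k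
    by (simp add: rpl_stepsize_def power2_eq_square power4_eq_xxxx)
  then show ?thesis using summable_mult[OF summable_gain, of "1 - \<eta>"] by simp
qed

end

end

theorem theorem3p3:
  fixes D :: "'a::{real_inner, complete_space} set"
    and F :: "'a \<Rightarrow> 'b::{real_inner, complete_space}"
    and y :: 'b and x0 xstar :: 'a
    and \<rho> C \<eta> :: real and \<theta> :: "nat \<Rightarrow> real"
  assumes A1: "assumption_A1 D F x0 \<rho> C"
    and A2: "tangential_cone_condition D F x0 \<rho> \<eta>"
    and A3: "xstar \<in> ball x0 (\<rho> / 2)" "F xstar = y"
    and theta: "\<And>k. 0 < \<theta> k \<and> \<theta> k < 2"
  shows "(\<exists>!x. is_rpl_sequence D F y \<eta> \<theta> x0 x) \<and>
    ball xstar (\<rho> / 2) \<subseteq> ball x0 \<rho> \<and>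
    (\<forall>x. is_rpl_sequence D F y \<eta> \<theta> x0 x \<longrightarrow>
       (\<forall>k. x k \<in> ball xstar (\<rho> / 2)) \<and>
       ((SUP k. \<theta> k) < 2 \<longrightarrow>
          summable (\<lambda>k. (1 - \<eta>)\<^sup>2 *
            (if landweber_direction D F y (x k) = 0 then 0
             else \<theta> k * ((norm (residual F y (x k))) ^ 4 /
                         (norm (landweber_direction D F y (x k)))\<^sup>2))) \<and>
          (\<exists>xbar \<in> ball x0 \<rho>. x \<longlonglongrightarrow> xbar)))"
proof -
  interpret tangential_cone D F y x0 xstar \<rho> \<eta>
    using A1 A2 A3 by unfold_locales (simp_all add: assumption_A1_def)
  let "_ \<and> _ \<and> (\<forall>x. ?run x \<longrightarrow> ?Q x)" = ?thesis
  have main: "?Q x" if "?run x" for x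
  proof -
    have init: "x 0 = x0" and step: "\<And>k. x (Suc k) = relaxed_step (\<theta> k) (x k)"
      using that by (auto simp: is_rpl_sequence_def)
    \<comment> \<open>A real supremum dominates the values only when the range is bounded above; the
      results on runs then apply with the supremum as \<open>q\<close>.\<close>
    have "bdd_above (range \<theta>)"
      using theta by (intro bdd_aboveI2[of _ _ 2]) (simp add: less_imp_le)
    then have "\<theta> k \<le> (SUP k. \<theta> k)" for k by (intro cSUP_upper) simp_all
    note run = init step conjunct1[OF theta] this
    show ?thesis
      by (intro conjI impI allI run_in_ball[OF init step theta] summable_run[OF run]
          run_converges[OF run])
  qed
  show ?thesis
    by (rule conjI[OF ex1_rpl_sequence[OF theta] conjI[OF ball_xstar_subset]])
      (intro allI impI main)
qed

end
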